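(* Let $G$ be a balanced signed block graph with $n$ vertices all of whose edges have weight $1$, with blocks $B_1,\dots,B_k$, and let $A$ be its adjacency matrix. Then $$\mathrm{per}(A)=\sum\prod_{i=1}^k \alpha_i!\sum_{j=0}^{\alpha_i}\frac{(-1)^j}{j!},$$ where the outer sum is over all $k$-tuples $(\alpha_1,\dots,\alpha_k)$ of nonnegative integers such that (1) $\sum_{i=1}^k\alpha_i=n$, and (2) for every nonempty $S\subseteq\{1,\dots,k\}$, $\sum_{i\in S}\alpha_i\le|V(G_S)|$, where $G_S$ is the subgraph of $G$ induced by the blocks $B_i$, $i\in S$.
   Context: A signed graph is a simple undirected graph with edge weights in $\{1,-1\}$; its adjacency matrix has $(i,j)$ entry equal to the weight of edge $\{i,j\}$ and $0$ otherwise. It is balanced if every cycle has positive product of edge weights. A block is a maximal connected subgraph without a cut-vertex; a signed block graph is a signed graph each of whose blocks is a (signed) complete graph. $\mathrm{per}$ denotes the permanent. *)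

theory Defs
  imports
    Complex_Main
    "HOL-Library.FuncSet"
    "HOL-Combinatorics.Permutations"
    "Jordan_Normal_Form.Matrix"
    "Graph_Theory.Graph_Theory"
begin

definition permanent :: "'a :: comm_ring_1 mat \<Rightarrow> 'a" where
  "permanent A = (if dim_row A = dim_col A
     then \<Sum>p | p permutes {0..<dim_row A}. \<Prod>i = 0..<dim_row A. A $$ (i, p i)
     else 0)"

text \<open>
  Simple undirected graphs are finite loop-free symmetric digraphs whose arcs are pairs of
  vertices. The weight function takes the undirected edge as the set of its two ends, so both
  orientations of an edge carry the same weight; its values off the edges are irrelevant.
\<close>

locale signed_graph = pair_graph G for G :: "'a pair_pre_digraph" +
  fixes w :: "'a set \<Rightarrow> real"
  assumes weight: "(x, y) \<in> parcs G \<Longrightarrow> w {x, y} \<in> {1, -1}"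

text \<open>The adjacency matrix with respect to the enumeration \<open>v 0, \<dots>, v (n - 1)\<close> of the vertices.\<close>

definition adjacency_mat ::
  "'a pair_pre_digraph \<Rightarrow> ('a set \<Rightarrow> real) \<Rightarrow> (nat \<Rightarrow> 'a) \<Rightarrow> real mat" where
  "adjacency_mat G w v = mat (card (pverts G)) (card (pverts G))
     (\<lambda>(i, j). if (v i, v j) \<in> parcs G then w {v i, v j} else 0)"

text \<open>
  In a symmetric digraph the closed walk \<open>a, b, a\<close> along an edge satisfies
  \<^const>\<open>pre_digraph.cycle\<close>; the bound on the length leaves the cycles of the undirected graph.
\<close>

definition balanced :: "'a pair_pre_digraph \<Rightarrow> ('a set \<Rightarrow> real) \<Rightarrow> bool" where
  "balanced G w \<longleftrightarrow> (\<forall>p. pre_digraph.cycle (with_proj G) p \<and> 3 \<le> length p \<longrightarrow>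
     0 < prod_list (map (\<lambda>(x, y). w {x, y}) p))"

text \<open>
  For a symmetric digraph the strongly connected components are the connected components of the
  undirected graph. The one-vertex graph has no cut-vertex: the null graph has no components.
\<close>

definition cut_vertex :: "('a, 'b) pre_digraph \<Rightarrow> 'a \<Rightarrow> bool" where
  "cut_vertex H x \<longleftrightarrow> x \<in> verts H \<and>
     card (pre_digraph.sccs H) < card (pre_digraph.sccs (pre_digraph.del_vert H x))"

text \<open>
  Subgraphs of \<open>G\<close> as an undirected graph are the symmetric ones. Connected graphs are nonempty,
  and an isolated vertex is a block.
\<close>

definition blocks :: "'a pair_pre_digraph \<Rightarrow> ('a, 'a \<times> 'a) pre_digraph set" where
  "blocks G = {B. pre_digraph.max_subgraph (with_proj G)
     (\<lambda>H. symmetric H \<and> Digraph_Component.connected H \<and> \<not> (\<exists>x. cut_vertex H x)) B}"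

locale signed_block_graph = signed_graph +
  assumes complete_blocks: "B \<in> blocks G \<Longrightarrow> \<exists>m. complete_digraph m B"

end

theory Submission
  imports Defs "HOL-Combinatorics.Orbits"
begin

text \<open>
  A closed chain of blocks, consecutive ones meeting in pairwise distinct vertices, has a union
  without cut-vertex, so by maximality all its blocks coincide. Apply this to the orbits of a
  permutation whose graph consists of arcs: each cycle stays inside one block. So such a
  permutation amounts to a choice \<open>f\<close> of a block \<open>f x\<close> through every vertex \<open>x\<close> and a derangement of
  each fibre of \<open>f\<close>, and the permanent is a sum over all \<open>f\<close> of products of derangement numbers.
  Applied to a permutation matching the fibres of two choices with equal fibre sizes \<open>\<alpha>\<close>, the same
  fact shows that \<open>f\<close> is determined by \<open>\<alpha>\<close>. The \<open>\<alpha>\<close> that occur are those meeting Hall's condition.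
\<close>

section \<open>Hall's theorem and derangements\<close>

text \<open>Induction on the number of indices. If some nonempty proper subfamily is tight, it is
  matched inside its own union and the remaining indices outside that union. Otherwise one index
  receives an arbitrary value, and all other sets can afford to lose it.\<close>

theorem hall_marriage:
  fixes A :: "'i \<Rightarrow> 'a set"
  assumes "finite I" and "\<And>i. i \<in> I \<Longrightarrow> finite (A i)"
    and "\<And>J. J \<subseteq> I \<Longrightarrow> card J \<le> card (\<Union>(A ` J))"
  shows "\<exists>r. inj_on r I \<and> (\<forall>i\<in>I. r i \<in> A i)"
  using assms
proof (induction "card I" arbitrary: I A rule: less_induct)
  case less
  note fin = less.prems(1,2) and hall = less.prems(3)
  show ?case
  proof (cases "I = {}")
    case False
    then obtain i0 where i0: "i0 \<in> I" by blast
    show ?thesis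
    proof (cases "\<exists>J. J \<noteq> {} \<and> J \<subset> I \<and> card (\<Union>(A ` J)) = card J")
      case True
      then obtain J where J: "J \<noteq> {}" "J \<subset> I" "card (\<Union>(A ` J)) = card J" by blast
      define U where "U = \<Union>(A ` J)"
      have JI: "J \<subseteq> I" using J by blast
      have finJ: "finite J" using JI fin(1) by (rule finite_subset)
      have finU: "finite U" unfolding U_def using JI fin(2) finJ by blast
      have "\<exists>r. inj_on r J \<and> (\<forall>i\<in>J. r i \<in> A i)"
        by (rule less.hyps[OF psubset_card_mono[OF fin(1) J(2)] finJ])
          (use JI fin(2) hall in blast)+
      then obtain r1 where r1: "inj_on r1 J" "\<forall>i\<in>J. r1 i \<in> A i" by blast
      \<comment> \<open>Hall's condition survives the removal of \<open>U\<close>: the union over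
        \<open>K \<union> J\<close> has at least \<open>card K + card J\<close> elements, and
        exactly \<open>card J\<close> of them lie in \<open>U\<close>.\<close>
      have "\<exists>r. inj_on r (I - J) \<and> (\<forall>i\<in>I - J. r i \<in> A i - U)"
      proof (rule less.hyps)
        have "I - J \<subset> I" using J by auto
        then show "card (I - J) < card I" using fin by (meson psubset_card_mono)
        show "card K \<le> card (\<Union>i\<in>K. A i - U)" if K: "K \<subseteq> I - J" for K
        proof -
          have finK: "finite K" using K fin by (meson finite_Diff finite_subset)
          have "card K + card J = card (K \<union> J)"
            using K finJ finK by (subst card_Un_disjoint) auto
          also have "\<dots> \<le> card (\<Union>(A ` (K \<union> J)))"
            using K JI by (intro hall) auto
          also have "\<Union>(A ` (K \<union> J)) = (\<Union>i\<in>K. A i - U) \<union> U"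
            by (auto simp: U_def)
          also have "card \<dots> = card (\<Union>i\<in>K. A i - U) + card J"
            using K finK finU fin J(3) by (subst card_Un_disjoint) (auto simp: U_def)
          finally show ?thesis by simp
        qed
      qed (use fin in auto)
      then obtain r2 where r2: "inj_on r2 (I - J)" "\<forall>i\<in>I - J. r2 i \<in> A i - U" by blast
      have "inj_on (\<lambda>i. if i \<in> J then r1 i else r2 i) I"
      proof (rule inj_onI)
        fix i j assume ij: "i \<in> I" "j \<in> I"
          "(if i \<in> J then r1 i else r2 i) = (if j \<in> J then r1 j else r2 j)"
        have "r1 i' \<noteq> r2 j'" if "i' \<in> J" "j' \<in> I - J" for i' j'
          using that r1(2) r2(2) by (auto simp: U_def)
        with ij have "i \<in> J \<longleftrightarrow> j \<in> J"
          by (metis DiffI)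
        with ij show "i = j"
          using inj_onD[OF r1(1), of i j] inj_onD[OF r2(1), of i j] by (auto split: if_splits)
      qed
      then show ?thesis
        using r1 r2 by (intro exI[of _ "\<lambda>i. if i \<in> J then r1 i else r2 i"]) auto
    next
      case notight: False
      have "card {i0} \<le> card (\<Union>(A ` {i0}))" using i0 by (intro hall) auto
      then obtain a where a: "a \<in> A i0" by (cases "A i0 = {}") auto
      have "\<exists>r. inj_on r (I - {i0}) \<and> (\<forall>i\<in>I - {i0}. r i \<in> A i - {a})"
      proof (rule less.hyps)
        show "card (I - {i0}) < card I" using i0 fin by (meson card_Diff1_less)
        show "card K \<le> card (\<Union>i\<in>K. A i - {a})" if K: "K \<subseteq> I - {i0}" for K
        proof (cases "K = {}")
          case False
          \<comment> \<open>Since \<open>K\<close> omits \<open>i0\<close>, it is a proper subfamily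
            and hence not tight; the spare element in its union pays for the loss of
            \<open>a\<close>.\<close>
          have "K \<subset> I" using K i0 by auto
          then have "card K \<le> card (\<Union>(A ` K))" "card (\<Union>(A ` K)) \<noteq> card K"
            using hall[of K] False notight by auto
          moreover have "(\<Union>i\<in>K. A i - {a}) = \<Union>(A ` K) - {a}" by auto
          moreover have "card (\<Union>(A ` K)) - 1 \<le> card (\<Union>(A ` K) - {a})"
            using diff_card_le_card_Diff[of "{a}" "\<Union>(A ` K)"] by simp
          ultimately show ?thesis by simp
        qed simp
      qed (use fin in auto)
      then obtain r where r: "inj_on r (I - {i0})" "\<forall>i\<in>I - {i0}. r i \<in> A i - {a}" by blast
      then have "inj_on (r(i0 := a)) (insert i0 (I - {i0}))"
        by (subst inj_on_insert) (auto simp: inj_on_def)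
      then have "inj_on (r(i0 := a)) I" using i0 by (simp add: insert_absorb)
      then show ?thesis
        using r a by (intro exI[of _ "r(i0 := a)"]) auto
    qed
  qed simp
qed

section \<open>Counting derangements by inclusion and exclusion\<close>

definition derangements :: "'a set \<Rightarrow> ('a \<Rightarrow> 'a) set" where
  "derangements S = {p. p permutes S \<and> (\<forall>x\<in>S. p x \<noteq> x)}"

lemma finite_derangements: "finite S \<Longrightarrow> finite (derangements S)"
  unfolding derangements_def by (rule finite_subset[OF _ finite_permutations]) auto

text \<open>Permutations of \<open>S\<close> are sorted by their set \<open>T\<close> of moved
  points, on which they are derangements. This is the summatory form that Moebius inversion
  needs.\<close>

lemma fact_eq_sum_card_derangements:
  assumes "finite S"
  shows "fact (card S) = (\<Sum>T\<in>Pow S. card (derangements T))"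
proof -
  have "{p. p permutes S} = (\<Union>T\<in>Pow S. derangements T)"
  proof (intro equalityI subsetI)
    fix p assume p: "p \<in> {p. p permutes S}"
    then have "p permutes {x \<in> S. p x \<noteq> x}"
      by (auto intro: permutes_superset)
    then show "p \<in> (\<Union>T\<in>Pow S. derangements T)"
      by (auto simp: derangements_def intro!: bexI[of _ "{x \<in> S. p x \<noteq> x}"])
  qed (auto simp: derangements_def intro: permutes_subset)
  then have "fact (card S) = card (\<Union>T\<in>Pow S. derangements T)"
    using card_permutations[OF refl assms] by simp
  also have "\<dots> = (\<Sum>T\<in>Pow S. card (derangements T))"
  proof (rule card_UN_disjoint)
    have "T = {x. p x \<noteq> x}" if "p \<in> derangements T" for p :: "'a \<Rightarrow> 'a" and T
      using that by (auto simp: derangements_def permutes_def)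
    then show "\<forall>T\<in>Pow S. \<forall>T'\<in>Pow S. T \<noteq> T' \<longrightarrow> derangements T \<inter> derangements T' = {}"
      by blast
  qed (use assms in \<open>auto intro: finite_derangements finite_subset\<close>)
  finally show ?thesis .
qed

text \<open>Moebius inversion over the subsets of \<open>S\<close> applied to the previous identity;
  subsets of equal size are then collected and the binomial coefficients cancelled against the
  factorials.\<close>

lemma card_derangements:
  assumes "finite S"
  shows "real (card (derangements S)) = fact (card S) * (\<Sum>j = 0..card S. (- 1) ^ j / fact j)"
proof -
  let ?n = "card S"
  have "real (card (derangements S)) = (\<Sum>T\<in>Pow S. (- 1) ^ (card S - card T) * fact (card T))"
  proof (rule inclusion_exclusion_mobius[OF _ assms])
    fix T :: "'a set" assume "finite T"
    then show "fact (card T) = (\<Sum>U\<in>Pow T. real (card (derangements U)))"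
      using fact_eq_sum_card_derangements[of T] by (metis of_nat_fact of_nat_sum)
  qed
  also have "\<dots> = (\<Sum>k\<in>{0..?n}. \<Sum>T | T \<in> Pow S \<and> card T = k. (- 1) ^ (card S - card T) * fact (card T))"
    using assms by (intro sum.group[symmetric]) (auto intro: card_mono)
  also have "\<dots> = (\<Sum>k = 0..?n. real (?n choose k) * ((- 1) ^ (?n - k) * fact k))"
    using n_subsets[OF assms] by (intro sum.cong) auto
  also have "\<dots> = (\<Sum>k = 0..?n. fact ?n * ((- 1) ^ (?n - k) / fact (?n - k)))"
    by (intro sum.cong) (auto simp: binomial_fact)
  also have "\<dots> = (\<Sum>k = 0..?n. fact ?n * ((- 1) ^ k / fact k))"
    by (rule sum.reindex_bij_witness[of _ "\<lambda>k. ?n - k" "\<lambda>k. ?n - k"]) auto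
  finally show ?thesis by (simp add: sum_distrib_left)
qed

section \<open>Families of sets without cycles\<close>

text \<open>Restriction to the fibres and gluing along them are mutually inverse, so the
  derangements of the fibres can be chosen independently. An index without preimage has an empty
  fibre and contributes the factor 1.\<close>

lemma card_fibrewise_derangements:
  assumes "finite V" "finite I" "f ` V \<subseteq> I"
  shows "card {p \<in> derangements V. \<forall>x\<in>V. f (p x) = f x} =
    (\<Prod>i\<in>I. card (derangements {x \<in> V. f x = i}))"
proof -
  define fib where "fib i = {x \<in> V. f x = i}" for i
  \<comment> \<open>\<open>perm_restrict\<close> fixes all points off the fibre, and
    \<open>split p\<close> is \<open>undefined\<close> off \<open>I\<close>, as membership in the
    extensional product demands.\<close>
  define split where "split p = (\<lambda>i\<in>I. perm_restrict p (fib i))" for p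
  define glue where "glue q x = (if x \<in> V then q (f x) x else x)" for q :: "'b \<Rightarrow> 'a \<Rightarrow> 'a" and x
  have glue_deranges: "glue q \<in> derangements V \<and> (\<forall>x\<in>V. f (glue q x) = f x)"
    if q: "q \<in> (\<Pi>\<^sub>E i\<in>I. derangements (fib i))" for q
  proof -
    have qi: "q (f x) permutes fib (f x)" "q (f x) x \<noteq> x" if "x \<in> V" for x
      using that q assms(3) by (fastforce simp: derangements_def fib_def PiE_iff)+
    have in_fib: "q (f x) x \<in> fib (f x)" if "x \<in> V" for x
      using permutes_in_image[OF qi(1)] that by (auto simp: fib_def)
    have pres: "f (glue q x) = f x" "glue q x \<in> V" if "x \<in> V" for x
      using in_fib[OF that] that by (auto simp: glue_def fib_def)
    \<comment> \<open>Equal images lie in the same fibre, because \<open>glue q\<close> preserves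
      \<open>f\<close>; there a single permutation acts.\<close>
    have "inj_on (glue q) V"
    proof (rule inj_onI)
      fix x y assume xy: "x \<in> V" "y \<in> V" "glue q x = glue q y"
      then have "f x = f y" using pres by metis
      with xy have "q (f x) x = q (f x) y" by (simp add: glue_def)
      then show "x = y" using qi(1)[OF xy(1)] by (meson injD permutes_inj)
    qed
    then have "bij_betw (glue q) V V"
      using pres assms(1) by (simp add: bij_betw_def endo_inj_surj image_subsetI)
    then have "glue q permutes V" by (rule bij_imp_permutes) (auto simp: glue_def)
    then show ?thesis using pres qi by (auto simp: derangements_def glue_def)
  qed
  have split_deranges: "perm_restrict p (fib i) \<in> derangements (fib i)"
    if p: "p \<in> derangements V" "\<forall>x\<in>V. f (p x) = f x" for p i
  proof -
    have pV: "p permutes V" using p by (simp add: derangements_def)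
    have "inj_on p (fib i)" using permutes_inj[OF pV] by (rule inj_on_subset) simp
    moreover have "p ` fib i \<subseteq> fib i" using p permutes_in_image[OF pV] by (auto simp: fib_def)
    moreover have "finite (fib i)" using assms(1) by (simp add: fib_def)
    ultimately have "bij_betw p (fib i) (fib i)"
      by (simp add: bij_betw_def endo_inj_surj)
    then have "bij_betw (perm_restrict p (fib i)) (fib i) (fib i)"
      by (rule bij_betw_cong[THEN iffD1, rotated]) (simp add: perm_restrict_def)
    then have "perm_restrict p (fib i) permutes fib i"
      by (rule bij_imp_permutes) (simp add: perm_restrict_def)
    then show ?thesis using p by (auto simp: derangements_def fib_def perm_restrict_def)
  qed
  have "bij_betw split {p \<in> derangements V. \<forall>x\<in>V. f (p x) = f x} (\<Pi>\<^sub>E i\<in>I. derangements (fib i))"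
  proof (rule bij_betw_byWitness[where f' = glue])
    show "\<forall>p\<in>{p \<in> derangements V. \<forall>x\<in>V. f (p x) = f x}. glue (split p) = p"
    proof
      fix p assume "p \<in> {p \<in> derangements V. \<forall>x\<in>V. f (p x) = f x}"
      then have "p x = x" if "x \<notin> V" for x
        using that by (auto simp: derangements_def permutes_def)
      moreover have "f x \<in> I" if "x \<in> V" for x using that assms(3) by blast
      ultimately show "glue (split p) = p"
        by (auto simp: glue_def split_def fib_def perm_restrict_def)
    qed
    show "\<forall>q\<in>\<Pi>\<^sub>E i\<in>I. derangements (fib i). split (glue q) = q"
    proof
      fix q assume q: "q \<in> (\<Pi>\<^sub>E i\<in>I. derangements (fib i))"
      show "split (glue q) = q"
      proof
        fix i show "split (glue q) i = q i"
        proof (cases "i \<in> I")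
          case True
          then have "q i permutes fib i" using q by (auto simp: derangements_def PiE_iff)
          then have "q i x = x" if "x \<notin> fib i" for x using that by (simp add: permutes_def)
          then show ?thesis using True
            by (auto simp: split_def glue_def fib_def perm_restrict_def)
        next
          case False
          then show ?thesis by (simp add: split_def PiE_arb[OF q])
        qed
      qed
    qed
    show "split ` {p \<in> derangements V. \<forall>x\<in>V. f (p x) = f x} \<subseteq> (\<Pi>\<^sub>E i\<in>I. derangements (fib i))"
      using split_deranges by (simp add: split_def image_subset_iff)
    show "glue ` (\<Pi>\<^sub>E i\<in>I. derangements (fib i)) \<subseteq> {p \<in> derangements V. \<forall>x\<in>V. f (p x) = f x}"
      using glue_deranges by blast
  qed
  from bij_betw_same_card[OF this] show ?thesis
    using assms(2) by (simp add: card_PiE fib_def)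
qed

text \<open>\<open>orbit_const\<close> expresses acyclicity of the family \<open>W\<close>: a closed
  chain of sets whose consecutive members meet in distinct points uses only one set. It is phrased
  by permutations because it is applied to the terms of a permanent and to matchings between fibres.
  The intended \<open>W\<close> are the vertex sets of the blocks.\<close>

locale cycle_free_cover =
  fixes V :: "'a set" and I :: "'i set" and W :: "'i \<Rightarrow> 'a set"
  assumes finite_V: "finite V" and finite_I: "finite I"
    and W_subset: "i \<in> I \<Longrightarrow> W i \<subseteq> V"
    and orbit_const: "\<And>D \<pi> b x. \<lbrakk>D \<subseteq> V; \<pi> permutes D; \<And>x. x \<in> D \<Longrightarrow> \<pi> x \<noteq> x;
      \<And>x. x \<in> D \<Longrightarrow> b x \<in> I \<and> x \<in> W (b x) \<and> \<pi> x \<in> W (b x); x \<in> D\<rbrakk> \<Longrightarrow> b (\<pi> x) = b x"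
begin

definition choices :: "('a \<Rightarrow> 'i) set" where
  "choices = {f \<in> V \<rightarrow>\<^sub>E I. \<forall>x\<in>V. x \<in> W (f x)}"

text \<open>Extensional on \<open>I\<close>, so that a profile is itself a summation index \<alpha>
  of the formula.\<close>

definition profile :: "('a \<Rightarrow> 'i) \<Rightarrow> 'i \<Rightarrow> nat" where
  "profile f = (\<lambda>i\<in>I. card {x \<in> V. f x = i})"

lemma finite_choices: "finite choices"
  unfolding choices_def
  by (rule finite_subset[OF _ finite_PiE[of V "\<lambda>_. I"]]) (use finite_V finite_I in auto)

text \<open>The transposition of \<open>x\<close> and \<open>y\<close>, with \<open>i\<close> chosen
  at \<open>x\<close> and \<open>j\<close> at \<open>y\<close>, is a closed chain of length
  two.\<close>

lemma common_pair_unique: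
  assumes "i \<in> I" "j \<in> I" "x \<noteq> y" "x \<in> W i" "y \<in> W i" "x \<in> W j" "y \<in> W j"
  shows "i = j"
proof -
  let ?b = "\<lambda>z. if z = x then i else j"
  have "?b (transpose x y x) = ?b x"
  proof (rule orbit_const[where D = "{x, y}" and \<pi> = "transpose x y" and b = ?b and x = x])
    show "transpose x y permutes {x, y}" by (rule permutes_swap_id) auto
    show "{x, y} \<subseteq> V" using assms W_subset by blast
  qed (use assms in auto)
  then show ?thesis using assms by simp
qed

text \<open>On the set \<open>D\<close> where \<open>f\<close> and \<open>g\<close> differ, their
  fibres still have equal sizes, so a permutation \<open>\<pi>\<close> of \<open>D\<close> carries
  each fibre of \<open>f\<close> to that of \<open>g\<close>. Both \<open>x\<close> and
  \<open>\<pi> x\<close> lie in \<open>W (f x)\<close>; acyclicity yields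
  \<open>f (\<pi> x) = f x = g (\<pi> x)\<close>, which is impossible in \<open>D\<close>.\<close>

lemma inj_on_profile: "inj_on profile choices"
proof (rule inj_onI)
  fix f g assume f: "f \<in> choices" and g: "g \<in> choices" and eq: "profile f = profile g"
  define D where "D = {x \<in> V. f x \<noteq> g x}"
  have fI: "f x \<in> I" "g x \<in> I" "x \<in> W (f x)" "x \<in> W (g x)" if "x \<in> V" for x
    using that f g by (auto simp: choices_def)
  have card_eq: "card {x \<in> D. f x = i} = card {x \<in> D. g x = i}" if "i \<in> I" for i
  proof -
    \<comment> \<open>The points where both choices equal \<open>i\<close> belong to both fibres and
      cancel.\<close>
    let ?E = "{x \<in> V. f x = i \<and> g x = i}"
    have "{x \<in> V. f x = i} = {x \<in> D. f x = i} \<union> ?E" "{x \<in> V. g x = i} = {x \<in> D. g x = i} \<union> ?E"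
      by (auto simp: D_def)
    moreover have "card ({x \<in> D. f x = i} \<union> ?E) = card {x \<in> D. f x = i} + card ?E"
      "card ({x \<in> D. g x = i} \<union> ?E) = card {x \<in> D. g x = i} + card ?E"
      using finite_V by (auto intro!: card_Un_disjoint simp: D_def)
    moreover have "card {x \<in> V. f x = i} = card {x \<in> V. g x = i}"
      using fun_cong[OF eq, of i] that by (simp add: profile_def)
    ultimately show ?thesis by simp
  qed
  have finD: "finite D" using finite_V by (simp add: D_def)
  have "\<exists>h. bij_betw h {x \<in> D. f x = i} {x \<in> D. g x = i}" if "i \<in> I" for i
    using card_eq[OF that] finD by (intro finite_same_card_bij) auto
  then obtain h where h: "\<And>i. i \<in> I \<Longrightarrow> bij_betw (h i) {x \<in> D. f x = i} {x \<in> D. g x = i}"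
    by metis
  define \<pi> where "\<pi> x = (if x \<in> D then h (f x) x else x)" for x
  have \<pi>: "\<pi> x \<in> D" "g (\<pi> x) = f x" if "x \<in> D" for x
    using that bij_betwE[OF h, of "f x"] fI by (auto simp: \<pi>_def D_def)
  have "inj_on \<pi> D"
  proof (rule inj_onI)
    fix x y assume xy: "x \<in> D" "y \<in> D" "\<pi> x = \<pi> y"
    then have "f x = f y" using \<pi> by metis
    moreover have "f x \<in> I" using xy fI by (auto simp: D_def)
    ultimately show "x = y"
      using xy h[of "f x"] by (auto simp: \<pi>_def dest!: bij_betw_imp_inj_on inj_onD)
  qed
  then have "bij_betw \<pi> D D"
    using \<pi> finD by (simp add: bij_betw_def endo_inj_surj image_subsetI)
  then have perm: "\<pi> permutes D" by (rule bij_imp_permutes) (simp add: \<pi>_def)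
  have "D = {}"
  proof (rule ccontr)
    assume "D \<noteq> {}"
    then obtain x where x: "x \<in> D" by blast
    have "f (\<pi> x) = f x"
    proof (rule orbit_const[OF _ perm _ _ x])
      \<comment> \<open>A fixed point would satisfy \<open>g x = f x\<close>.\<close>
      show "\<pi> x \<noteq> x" if "x \<in> D" for x using \<pi>[OF that] that by (auto simp: D_def)
      show "f x \<in> I \<and> x \<in> W (f x) \<and> \<pi> x \<in> W (f x)" if "x \<in> D" for x
        using \<pi>[OF that] fI(1,3)[of x] fI(4)[of "\<pi> x"] that by (auto simp: D_def)
    qed (simp add: D_def)
    then show False using \<pi>[OF x] by (auto simp: D_def)
  qed
  then have "f x = g x" if "x \<in> V" for x using that by (auto simp: D_def)
  then show "f = g" using f g by (auto simp: choices_def intro: PiE_ext)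
qed

text \<open>Necessity: the points with value in \<open>S\<close> all lie in the union of
  \<open>W\<close> over \<open>S\<close>. Sufficiency: each \<open>i\<close> gets \<alpha>
  \<open>i\<close> slots, and Hall's theorem assigns to the slots distinct points of their sets.
  There are \<open>card V\<close> slots, so every point is used once, and the inverse assignment is
  a choice with profile \<alpha>.\<close>

lemma profile_image:
  "profile ` choices = {\<alpha> \<in> I \<rightarrow>\<^sub>E UNIV. (\<Sum>i\<in>I. \<alpha> i) = card V \<and>
     (\<forall>S. S \<noteq> {} \<and> S \<subseteq> I \<longrightarrow> (\<Sum>i\<in>S. \<alpha> i) \<le> card (\<Union>(W ` S)))}" (is "_ = ?R")
proof (intro equalityI subsetI)
  fix \<alpha> assume "\<alpha> \<in> profile ` choices"
  then obtain f where f: "f \<in> choices" and \<alpha>: "\<alpha> = profile f" by blast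
  have sum_eq: "(\<Sum>i\<in>S. \<alpha> i) = card {x \<in> V. f x \<in> S}" if "S \<subseteq> I" for S
  proof -
    have "finite S" using that finite_I by (rule finite_subset)
    have "(\<Sum>i\<in>S. \<alpha> i) = (\<Sum>i\<in>S. card {x \<in> V. f x = i})"
      using that by (intro sum.cong) (auto simp: \<alpha> profile_def)
    also have "\<dots> = card (\<Union>i\<in>S. {x \<in> V. f x = i})"
      using \<open>finite S\<close> finite_V by (intro card_UN_disjoint[symmetric]) auto
    also have "(\<Union>i\<in>S. {x \<in> V. f x = i}) = {x \<in> V. f x \<in> S}" by auto
    finally show ?thesis .
  qed
  have "{x \<in> V. f x \<in> I} = V" using f by (auto simp: choices_def)
  moreover have "card {x \<in> V. f x \<in> S} \<le> card (\<Union>(W ` S))" if "S \<subseteq> I" for S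
  proof (rule card_mono)
    show "finite (\<Union>(W ` S))"
      using that W_subset by (intro finite_subset[OF _ finite_V]) blast
  qed (use f in \<open>auto simp: choices_def\<close>)
  moreover have "\<alpha> \<in> I \<rightarrow>\<^sub>E UNIV" by (simp add: \<alpha> profile_def)
  ultimately show "\<alpha> \<in> ?R" using sum_eq by simp
next
  fix \<alpha> assume "\<alpha> \<in> ?R"
  then have ext: "\<alpha> \<in> I \<rightarrow>\<^sub>E UNIV" and total: "(\<Sum>i\<in>I. \<alpha> i) = card V"
    and hall: "\<And>S. S \<noteq> {} \<Longrightarrow> S \<subseteq> I \<Longrightarrow> (\<Sum>i\<in>S. \<alpha> i) \<le> card (\<Union>(W ` S))" by auto
  define slots where "slots = Sigma I (\<lambda>i. {..<\<alpha> i})"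
  have fin_slots: "finite slots" using finite_I by (simp add: slots_def)
  have card_slots: "card slots = card V" using finite_I total by (simp add: slots_def)
  have "\<exists>r. inj_on r slots \<and> (\<forall>s\<in>slots. r s \<in> W (fst s))"
  proof (rule hall_marriage[OF fin_slots])
    show "finite (W (fst s))" if "s \<in> slots" for s
      using that finite_subset[OF W_subset finite_V] by (auto simp: slots_def)
    show "card J \<le> card (\<Union>s\<in>J. W (fst s))" if J: "J \<subseteq> slots" for J
    proof (cases "J = {}")
      case False
      have S: "fst ` J \<subseteq> I" using J by (auto simp: slots_def)
      then have finS: "finite (fst ` J)" using finite_I by (rule finite_subset)
      have "card J \<le> card (Sigma (fst ` J) (\<lambda>i. {..<\<alpha> i}))"
        using J finS by (intro card_mono) (force simp: slots_def)+
      also have "\<dots> = (\<Sum>i\<in>fst ` J. \<alpha> i)" using finS by simp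
      also have "\<dots> \<le> card (\<Union>(W ` fst ` J))" using False S by (intro hall) auto
      finally show ?thesis by (simp add: image_image)
    qed simp
  qed
  then obtain r where r: "inj_on r slots" "\<And>s. s \<in> slots \<Longrightarrow> r s \<in> W (fst s)" by blast
  have "r ` slots \<subseteq> V" using r(2) W_subset by (force simp: slots_def)
  then have surj: "r ` slots = V"
    using card_slots card_image[OF r(1)] by (intro card_subset_eq finite_V) auto
  \<comment> \<open>The index of the slot matched with \<open>x\<close>.\<close>
  define f where "f = (\<lambda>x\<in>V. fst (inv_into slots r x))"
  have f_r: "f (r s) = fst s" if "s \<in> slots" for s
    using that r(1) surj by (auto simp: f_def)
  have "f \<in> choices"
  proof -
    have "f x \<in> I \<and> x \<in> W (f x)" if "x \<in> V" for x
    proof -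
      obtain s where "s \<in> slots" "x = r s" using \<open>x \<in> V\<close> surj by blast
      then show ?thesis using f_r r(2) by (auto simp: slots_def)
    qed
    then show ?thesis by (auto simp: choices_def f_def)
  qed
  moreover have "profile f = \<alpha>"
  proof
    fix i show "profile f i = \<alpha> i"
    proof (cases "i \<in> I")
      case True
      have "{x \<in> V. f x = i} = r ` {s \<in> slots. fst s = i}"
        using f_r surj by auto
      moreover have "inj_on r {s \<in> slots. fst s = i}"
        using r(1) by (rule inj_on_subset) auto
      moreover have "{s \<in> slots. fst s = i} = {i} \<times> {..<\<alpha> i}"
        using True by (auto simp: slots_def)
      ultimately show ?thesis using True by (simp add: profile_def card_image)
    next
      case False
      then show ?thesis by (simp add: profile_def PiE_arb[OF ext])
    qed
  qed
  ultimately show "\<alpha> \<in> profile ` choices" by blast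
qed

text \<open>The permutations are split according to the choice whose fibres they preserve: it exists
  by acyclicity and is unique by \<open>common_pair_unique\<close>. Each class is counted fibre by
  fibre, which depends on the profile only, and the profile determines the choice.\<close>

theorem card_supported_derangements:
  "real (card {p \<in> derangements V. \<forall>x\<in>V. \<exists>i\<in>I. x \<in> W i \<and> p x \<in> W i}) =
    (\<Sum>\<alpha> | \<alpha> \<in> I \<rightarrow>\<^sub>E (UNIV :: nat set) \<and> (\<Sum>i\<in>I. \<alpha> i) = card V \<and>
        (\<forall>S. S \<noteq> {} \<and> S \<subseteq> I \<longrightarrow> (\<Sum>i\<in>S. \<alpha> i) \<le> card (\<Union>(W ` S))).
      \<Prod>i\<in>I. fact (\<alpha> i) * (\<Sum>j = 0..\<alpha> i. (- 1) ^ j / fact j))"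
    (is "real (card ?P) = _")
proof -
  define F where "F f = {p \<in> derangements V. \<forall>x\<in>V. f (p x) = f x}" for f :: "'a \<Rightarrow> 'i"
  have "?P = (\<Union>f\<in>choices. F f)"
  proof (intro equalityI subsetI)
    fix p assume p: "p \<in> ?P"
    then have pV: "p permutes V" "\<And>x. x \<in> V \<Longrightarrow> p x \<noteq> x" by (auto simp: derangements_def)
    from p obtain b where b: "\<And>x. x \<in> V \<Longrightarrow> b x \<in> I \<and> x \<in> W (b x) \<and> p x \<in> W (b x)"
      by simp metis
    have "b (p x) = b x" if "x \<in> V" for x
      by (rule orbit_const[OF _ pV(1) _ b that]) (use pV in auto)
    then have "p \<in> F (restrict b V)"
      using p permutes_in_image[OF pV(1)] by (auto simp: F_def)
    moreover have "restrict b V \<in> choices" using b by (auto simp: choices_def)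
    ultimately show "p \<in> (\<Union>f\<in>choices. F f)" by blast
  next
    fix p assume "p \<in> (\<Union>f\<in>choices. F f)"
    then obtain f where f: "f \<in> choices" "p \<in> F f" by blast
    then have "p permutes V" by (simp add: F_def derangements_def)
    have "f x \<in> I \<and> x \<in> W (f x) \<and> p x \<in> W (f x)" if "x \<in> V" for x
    proof -
      have "p x \<in> V" using \<open>p permutes V\<close> that by (simp add: permutes_in_image)
      \<comment> \<open>Here \<open>f (p x) = f x\<close>, so the set chosen at \<open>x\<close>
        also contains \<open>p x\<close>.\<close>
      then have "p x \<in> W (f (p x))" using f(1) by (simp add: choices_def)
      then show ?thesis using f that by (auto simp: choices_def F_def)
    qed
    then show "p \<in> ?P" using f(2) by (auto simp: F_def)
  qed
  also have "card \<dots> = (\<Sum>f\<in>choices. card (F f))"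
  proof (rule card_UN_disjoint[OF finite_choices])
    show "\<forall>f\<in>choices. finite (F f)" using finite_derangements[OF finite_V] by (simp add: F_def)
    have "f = g" if fg: "f \<in> choices" "g \<in> choices" "p \<in> F f" "p \<in> F g" for f g p
    proof -
      have pV: "p permutes V" using fg by (simp add: F_def derangements_def)
      have "f x = g x" if x: "x \<in> V" for x
      proof (rule common_pair_unique)
        have px: "p x \<in> V" using pV x by (simp add: permutes_in_image)
        show "f x \<in> I" "g x \<in> I" "x \<in> W (f x)" "x \<in> W (g x)"
          using fg x by (auto simp: choices_def)
        show "x \<noteq> p x" using fg(3) x by (auto simp: F_def derangements_def)
        have "f (p x) = f x" "g (p x) = g x" using fg x by (auto simp: F_def)
        then show "p x \<in> W (f x)" "p x \<in> W (g x)"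
          using fg px by (auto simp: choices_def)
      qed
      then show ?thesis using fg by (auto simp: choices_def intro: PiE_ext)
    qed
    then show "\<forall>f\<in>choices. \<forall>g\<in>choices. f \<noteq> g \<longrightarrow> F f \<inter> F g = {}" by blast
  qed
  also have "\<dots> = (\<Sum>f\<in>choices. \<Prod>i\<in>I. card (derangements {x \<in> V. f x = i}))"
    unfolding F_def using finite_V finite_I
    by (intro sum.cong card_fibrewise_derangements) (auto simp: choices_def)
  finally have "real (card ?P) = (\<Sum>f\<in>choices. \<Prod>i\<in>I. real (card (derangements {x \<in> V. f x = i})))"
    by simp
  also have "\<dots> = (\<Sum>f\<in>choices.
      \<Prod>i\<in>I. fact (profile f i) * (\<Sum>j = 0..profile f i. (- 1) ^ j / fact j))"
    using finite_V by (intro sum.cong prod.cong) (auto simp: card_derangements profile_def)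
  also have "\<dots> = (\<Sum>\<alpha>\<in>profile ` choices. \<Prod>i\<in>I. fact (\<alpha> i) * (\<Sum>j = 0..\<alpha> i. (- 1) ^ j / fact j))"
    by (simp add: sum.reindex[OF inj_on_profile])
  finally show ?thesis by (simp add: profile_image)
qed

end

section \<open>Blocks\<close>

definition nonseparable :: "('a, 'b) pre_digraph \<Rightarrow> bool" where
  "nonseparable H \<longleftrightarrow> symmetric H \<and> Digraph_Component.connected H \<and> \<not> (\<exists>x. cut_vertex H x)"

lemma blocks_eq: "blocks G = {B. pre_digraph.max_subgraph (with_proj G) nonseparable B}"
  by (simp add: blocks_def nonseparable_def[abs_def])

lemma (in wf_digraph) del_vert_induce: "pre_digraph.del_vert (G \<restriction> U) x = G \<restriction> (U - {x})"
  by (auto simp: pre_digraph.del_vert_def induce_subgraph_def)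

text \<open>\<open>Z\<close> is empty or the singleton of \<open>y\<close>. The empty case gives
  connectedness; the singleton case leaves at most one component after deleting a vertex, so the
  number of components cannot grow.\<close>

lemma (in sym_digraph) nonseparable_induce:
  assumes U: "U \<subseteq> verts G" "U \<noteq> {}"
    and reach: "\<And>y Z u v. \<lbrakk>Z \<subseteq> {y}; u \<in> U - Z; v \<in> U - Z\<rbrakk> \<Longrightarrow> u \<rightarrow>\<^sup>*\<^bsub>G \<restriction> (U - Z)\<^esub> v"
  shows "nonseparable (G \<restriction> U)"
proof -
  interpret H: wf_digraph "G \<restriction> U" by (rule wellformed_induce_subgraph)
  have sym: "symmetric (G \<restriction> U)"
    using sym_arcs induced_induce[OF U(1)] by (rule induced_graph_imp_symmetric)
  have sc: "strongly_connected (G \<restriction> U)"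
    using reach[of "{}"] U(2) by (intro strongly_connectedI) auto
  \<comment> \<open>Connectedness is defined through the symmetric closure, which has the same
    reachability as a graph that is already symmetric.\<close>
  then have "strongly_connected (with_proj (mk_symmetric (G \<restriction> U)))"
    by (simp add: strongly_connected_def H.reachable_mk_symmetric_eq[OF sym])
  then have conn: "Digraph_Component.connected (G \<restriction> U)" by (simp add: connected_def)
  have "\<not> cut_vertex (G \<restriction> U) x" for x
  proof -
    interpret K: wf_digraph "G \<restriction> (U - {x})" by (rule wellformed_induce_subgraph)
    have "card (pre_digraph.sccs (G \<restriction> (U - {x}))) \<le> 1"
    proof (cases "U - {x} = {}")
      \<comment> \<open>Deleting the only vertex leaves the null graph, which has no component since
        strongly connected graphs are nonempty.\<close>
      case True
      then have "pre_digraph.sccs (G \<restriction> (U - {x})) = {}"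
        by (auto simp: K.sccs_def induced_subgraph_def subgraph_def strongly_connected_def)
      then show ?thesis by simp
    next
      case False
      then have "strongly_connected (G \<restriction> (U - {x}))"
        using reach[of "{x}" x] by (intro strongly_connectedI) auto
      then show ?thesis by (simp add: K.strongly_connected_eq_iff)
    qed
    moreover have "card (pre_digraph.sccs (G \<restriction> U)) = 1"
      using sc by (simp add: H.strongly_connected_eq_iff)
    ultimately show ?thesis by (simp add: cut_vertex_def del_vert_induce)
  qed
  with sym conn show ?thesis by (simp add: nonseparable_def)
qed

lemma (in sym_digraph) nonseparable_induce_clique:
  assumes U: "U \<subseteq> verts G" "U \<noteq> {}"
    and clique: "\<And>u v. \<lbrakk>u \<in> U; v \<in> U; u \<noteq> v\<rbrakk> \<Longrightarrow> u \<rightarrow> v"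
  shows "nonseparable (G \<restriction> U)"
proof (rule nonseparable_induce[OF U])
  fix y Z u v assume uv: "u \<in> U - Z" "v \<in> U - Z"
  interpret K: wf_digraph "G \<restriction> (U - Z)" by (rule wellformed_induce_subgraph)
  show "u \<rightarrow>\<^sup>*\<^bsub>G \<restriction> (U - Z)\<^esub> v"
  proof (cases "u = v")
    case False
    then have "u \<rightarrow>\<^bsub>G \<restriction> (U - Z)\<^esub> v" using uv clique[of u v] by (auto simp: arcs_ends_conv)
    then show ?thesis by (rule K.reachable_adjI)
  qed (use uv in auto)
qed

text \<open>The size bound makes both inclusions equalities, and \<open>compatible\<close>
  identifies the tail and head maps.\<close>

lemma subgraph_card_eq:
  assumes "subgraph H H'" "finite (verts H')" "finite (arcs H')"
    and "card (verts H') + card (arcs H') \<le> card (verts H) + card (arcs H)"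
  shows "H' = H"
proof -
  have sub: "verts H \<subseteq> verts H'" "arcs H \<subseteq> arcs H'" and "compatible H' H"
    using assms(1) by auto
  moreover have "card (verts H) \<le> card (verts H')" "card (arcs H) \<le> card (arcs H')"
    using sub assms by (simp_all add: card_mono)
  ultimately have "verts H = verts H'" "arcs H = arcs H'"
    using assms(4) card_subset_eq[OF assms(2) sub(1)] card_subset_eq[OF assms(3) sub(2)] by simp_all
  then show ?thesis
    using \<open>compatible H' H\<close> by (auto simp: compatible_def intro: pre_digraph.equality)
qed

text \<open>Among the subgraphs with \<open>P\<close> that contain \<open>K\<close>, one with the
  greatest number of vertices plus arcs is maximal.\<close>

lemma (in fin_digraph) max_subgraph_exists:
  assumes "subgraph K G" "P K"
  shows "\<exists>H. max_subgraph P H \<and> subgraph K H"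
proof -
  let ?Q = "\<lambda>H. subgraph K H \<and> subgraph H G \<and> P H"
  let ?size = "\<lambda>H. card (verts H) + card (arcs H)"
  have "wf_digraph K" using assms(1) by auto
  then have "?Q K" using assms by (simp add: wf_digraph.subgraph_refl)
  moreover have "\<forall>H. ?Q H \<longrightarrow> ?size H < Suc (?size G)"
    by (auto simp: subgraph_def less_Suc_eq_le intro!: add_mono card_mono)
  ultimately obtain H where H: "?Q H" "\<And>H'. ?Q H' \<Longrightarrow> ?size H' \<le> ?size H"
    using ex_has_greatest_nat[of ?Q K ?size "Suc (?size G)"] by blast
  have "H' = H" if H': "subgraph H H'" "subgraph H' G" "P H'" for H'
  proof (rule subgraph_card_eq[OF H'(1)])
    show "finite (verts H')" "finite (arcs H')"
      using H'(2) finite_verts finite_arcs by (auto simp: subgraph_def intro: finite_subset)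
    show "?size H' \<le> ?size H" using H' H(1) by (intro H(2)) (auto intro: subgraph_trans)
  qed
  with H(1) show ?thesis by (auto simp: max_subgraph_def)
qed

section \<open>Blocks that are cliques, and closed chains of them\<close>

context signed_block_graph
begin

lemma block_subgraph: "B \<in> blocks G \<Longrightarrow> subgraph B (with_proj G)"
  by (simp add: blocks_eq max_subgraph_def)

lemma block_verts_subset: "B \<in> blocks G \<Longrightarrow> verts B \<subseteq> pverts G"
  using block_subgraph by fastforce

lemma block_clique:
  assumes "B \<in> blocks G" "x \<in> verts B" "y \<in> verts B" "x \<noteq> y"
  shows "(x, y) \<in> parcs G"
proof -
  have "(x, y) \<in> arcs_ends B"
    using complete_blocks[OF assms(1)] assms by (auto simp: complete_digraph_def)
  moreover have "arcs_ends B \<subseteq> arcs_ends (with_proj G)"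
    using block_subgraph[OF assms(1)] by (rule arcs_ends_mono)
  ultimately show ?thesis by auto
qed

text \<open>An edge with its two ends is nonseparable, so it extends to a maximal nonseparable
  subgraph.\<close>

lemma arc_in_block:
  assumes "(x, y) \<in> parcs G"
  shows "\<exists>B\<in>blocks G. x \<in> verts B \<and> y \<in> verts B"
proof -
  have xy: "{x, y} \<subseteq> pverts G" "(y, x) \<in> parcs G"
    using assms arc_fst_in_verts[OF assms] arc_snd_in_verts[OF assms] sym_arcs
    by (auto simp: symmetric_def sym_def)
  have "nonseparable (with_proj G \<restriction> {x, y})"
    by (rule nonseparable_induce_clique) (use assms xy in auto)
  moreover have "subgraph (with_proj G \<restriction> {x, y}) (with_proj G)"
    using induced_induce[of "{x, y}"] xy by auto
  ultimately obtain B where "B \<in> blocks G" "subgraph (with_proj G \<restriction> {x, y}) B"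
    using max_subgraph_exists unfolding blocks_eq by blast
  then show ?thesis by (auto simp: subgraph_def)
qed

text \<open>The blocks chosen along the orbit of \<open>x\<close> form a closed chain:
  \<open>b z\<close> and \<open>b (\<pi> z)\<close> share \<open>\<pi> z\<close>. Blocks are
  cliques, so the subgraph induced on their union \<open>U\<close> stays connected when one vertex
  is deleted. It is nonseparable and contains each of these blocks, hence equals each of
  them.\<close>

lemma block_const_on_orbit:
  assumes \<pi>: "\<pi> permutes D" "finite D" and nofix: "\<And>x. x \<in> D \<Longrightarrow> \<pi> x \<noteq> x"
    and b: "\<And>x. x \<in> D \<Longrightarrow> b x \<in> blocks G \<and> x \<in> verts (b x) \<and> \<pi> x \<in> verts (b x)"
    and x: "x \<in> D"
  shows "b (\<pi> x) = b x"
proof -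
  define C where "C = orbit \<pi> x"
  define U where "U = (\<Union>z\<in>C. verts (b z))"
  have cyc: "cyclic_on \<pi> C" unfolding C_def using \<pi> by (rule cyclic_on_orbit)
  have orbC: "orbit \<pi> z = C" if "z \<in> C" for z using cyc that by (rule orbit_cyclic_eq3)
  have step_C: "\<pi> z \<in> C" if "z \<in> C" for z using that by (simp add: C_def orbit.step)
  have xC: "x \<in> C"
    unfolding C_def using \<pi> by (intro permutation_self_in_orbit) (auto simp: permutation_permutes)
  have CD: "C \<subseteq> D" unfolding C_def using \<pi>(1) x by (rule permutes_orbit_subset)
  have b_C: "b z \<in> blocks G" "z \<in> verts (b z)" "\<pi> z \<in> verts (b z)" "\<pi> z \<noteq> z" if "z \<in> C" for z
    using that b[of z] nofix[of z] CD by auto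
  have UG: "U \<subseteq> pverts G" using b_C(1) block_verts_subset unfolding U_def by blast
  have "nonseparable (with_proj G \<restriction> U)"
  proof (rule nonseparable_induce)
    fix y Z u v assume Z: "Z \<subseteq> {y}" and uv: "u \<in> U - Z" "v \<in> U - Z"
    define K where "K = with_proj G \<restriction> (U - Z)"
    interpret K: wf_digraph K unfolding K_def by (rule wellformed_induce_subgraph)
    have symK: "symmetric K"
      unfolding K_def using UG
      by (intro induced_graph_imp_symmetric[OF sym_arcs] induced_induce) auto
    have adj: "s \<rightarrow>\<^sup>*\<^bsub>K\<^esub> t" if "z \<in> C" "s \<in> verts (b z) - Z" "t \<in> verts (b z) - Z" for s t z
    proof (cases "s = t")
      case True
      moreover have "t \<in> verts K" using that by (auto simp: K_def U_def)
      ultimately show ?thesis by (simp add: K.reachable_refl)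
    next
      case False
      have "(s, t) \<in> parcs G" using that b_C(1) False by (intro block_clique[of "b z"]) auto
      then have "s \<rightarrow>\<^bsub>K\<^esub> t" using that by (auto simp: K_def U_def arcs_ends_conv)
      then show ?thesis by (rule K.reachable_adjI)
    qed
    \<comment> \<open>If \<open>Z\<close> meets the orbit, \<open>c\<close> is the deleted vertex;
      otherwise any orbit vertex will do. As \<open>\<pi> c\<close> differs from \<open>c\<close>,
      it survives and serves as base point.\<close>
    obtain c where c: "c \<in> C" "C \<inter> Z \<subseteq> {c}" using xC Z by blast
    have notin_Z: "e \<notin> Z" if "e \<in> C" "e \<noteq> c" for e using that c(2) by auto
    have start: "\<pi> c \<rightarrow>\<^sup>*\<^bsub>K\<^esub> \<pi> c"
      using c(1) by (intro adj[of c] DiffI b_C notin_Z step_C)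
    \<comment> \<open>Deleting \<open>Z\<close> cuts the closed chain of blocks at most at \<open>c\<close>, so it can be walked from \<open>\<pi> c\<close> round to \<open>c\<close>.\<close>
    have walk: "\<pi> c \<rightarrow>\<^sup>*\<^bsub>K\<^esub> e" if "e \<in> orbit \<pi> c" "e \<noteq> c" for e
      using that
    proof (induction rule: orbit.induct)
      case base
      show ?case by (rule start)
    next
      case (step e)
      have eC: "e \<in> C" "\<pi> e \<in> C" using step.hyps orbC[OF c(1)] step_C by auto
      show ?case
      proof (cases "e = c")
        \<comment> \<open>The orbit has been traversed once, and its next vertex is the base point
          again.\<close>
        case True
        then show ?thesis using start by simp
      next
        case False
        then have "\<pi> c \<rightarrow>\<^sup>*\<^bsub>K\<^esub> e" by (rule step.IH)
        also have "e \<rightarrow>\<^sup>*\<^bsub>K\<^esub> \<pi> e"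
          using eC False step.prems by (intro adj[of e] DiffI b_C notin_Z)
        finally show ?thesis .
      qed
    qed
    have reach_C: "\<pi> c \<rightarrow>\<^sup>*\<^bsub>K\<^esub> e" if "e \<in> C" "e \<notin> Z" for e
    proof (cases "e = c")
      case True
      have "\<pi> c \<notin> Z" using c(1) by (intro notin_Z step_C b_C)
      then have "\<pi> c \<rightarrow>\<^sup>*\<^bsub>K\<^esub> c" using that True b_C[OF c(1)] by (intro adj[OF c(1)]) auto
      then show ?thesis using True by simp
    next
      case False
      then show ?thesis using that orbC[OF c(1)] by (intro walk) simp_all
    qed
    have reach_U: "\<pi> c \<rightarrow>\<^sup>*\<^bsub>K\<^esub> t" if "t \<in> U - Z" for t
    proof -
      from that obtain z where z: "z \<in> C" "t \<in> verts (b z)" by (auto simp: U_def)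
      \<comment> \<open>Of the two distinct vertices \<open>z\<close> and \<open>\<pi> z\<close> of
        the block, at least one survives; it is reached along the orbit, and \<open>t\<close> from
        it inside the clique.\<close>
      have "z \<notin> Z \<or> \<pi> z \<notin> Z" using b_C(4)[OF z(1)] Z by (metis singletonD subsetD)
      then obtain e where e: "e \<in> C" "e \<notin> Z" "e \<in> verts (b z)"
        using z(1) step_C b_C by metis
      have "\<pi> c \<rightarrow>\<^sup>*\<^bsub>K\<^esub> e" using e(1,2) by (rule reach_C)
      also have "e \<rightarrow>\<^sup>*\<^bsub>K\<^esub> t" using e z that by (intro adj[OF z(1)]) auto
      finally show ?thesis .
    qed
    have "u \<rightarrow>\<^sup>*\<^bsub>K\<^esub> \<pi> c" using symmetric_reachable[OF symK reach_U[OF uv(1)]] .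
    also have "\<pi> c \<rightarrow>\<^sup>*\<^bsub>K\<^esub> v" using uv(2) by (rule reach_U)
    finally show "u \<rightarrow>\<^sup>*\<^bsub>with_proj G \<restriction> (U - Z)\<^esub> v" by (simp add: K_def)
  next
    show "U \<noteq> {}" using xC b_C(2) by (auto simp: U_def)
  qed (use UG in simp)
  moreover have "subgraph (with_proj G \<restriction> U) (with_proj G)"
    using induced_induce[of U] UG by auto
  \<comment> \<open>The arcs of the block end in its own vertices, so they survive the restriction
    to \<open>U\<close>.\<close>
  moreover have "subgraph (b z) (with_proj G \<restriction> U)" if "z \<in> C" for z
  proof -
    have "subgraph (b z) (with_proj G)" using b_C(1)[OF that] by (rule block_subgraph)
    moreover have "verts (b z) \<subseteq> U" using that by (auto simp: U_def)
    ultimately show ?thesis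
      using wellformed_induce_subgraph[of U]
      by (auto simp: subgraph_def compatible_def dest: wf_digraph.wellformed)
  qed
  ultimately have "with_proj G \<restriction> U = b z" if "z \<in> C" for z
    using that b_C(1)[OF that] unfolding blocks_eq max_subgraph_def by auto
  then show ?thesis using xC step_C by metis
qed

end

section \<open>The permanent\<close>

text \<open>The product belonging to a permutation is 1 if all its steps satisfy \<open>R\<close>
  and 0 otherwise; the enumeration \<open>v\<close> transports permutations of indices to
  permutations of \<open>V\<close>.\<close>

lemma permanent_zero_one:
  assumes "bij_betw v {0..<n} V"
  shows "permanent (mat n n (\<lambda>(i, j). if R (v i) (v j) then 1 else (0::real))) =
    real (card {p. p permutes V \<and> (\<forall>x\<in>V. R x (p x))})"
proof -
  \<comment> \<open>Conjugation by \<open>v\<close>, extended by the identity off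
    \<open>V\<close>.\<close>
  define \<Phi> where "\<Phi> p x = (if x \<in> V then v (p (inv_into {0..<n} v x)) else x)" for p x
  have \<Phi>: "bij_betw \<Phi> {p. p permutes {0..<n}} {p. p permutes V}"
    using bij_betw_permutations[OF assms] by (simp add: \<Phi>_def[abs_def])
  have V: "V = v ` {0..<n}" using assms by (simp add: bij_betw_def)
  have "inv_into {0..<n} v (v i) = i" if "i < n" for i
    using assms that by (simp add: bij_betw_def)
  then have \<Phi>_iff: "(\<forall>x\<in>V. R x (\<Phi> p x)) \<longleftrightarrow> (\<forall>i\<in>{0..<n}. R (v i) (v (p i)))" for p
    by (simp add: V \<Phi>_def)
  have "bij_betw \<Phi> {p. p permutes {0..<n} \<and> (\<forall>i\<in>{0..<n}. R (v i) (v (p i)))}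
      {p. p permutes V \<and> (\<forall>x\<in>V. R x (p x))}" (is "bij_betw _ ?P ?Q")
  proof (rule bij_betw_subset[OF \<Phi>])
    show "\<Phi> ` ?P = ?Q"
    proof (intro equalityI subsetI)
      fix q assume q: "q \<in> ?Q"
      then obtain p where "p permutes {0..<n}" "q = \<Phi> p"
        using \<Phi> by (auto simp: bij_betw_def)
      then show "q \<in> \<Phi> ` ?P" using q \<Phi>_iff by blast
    next
      fix q assume "q \<in> \<Phi> ` ?P"
      then show "q \<in> ?Q" using bij_betwE[OF \<Phi>] \<Phi>_iff by blast
    qed
  qed auto
  then have "card ?P = card ?Q" by (rule bij_betw_same_card)
  moreover have "permanent (mat n n (\<lambda>(i, j). if R (v i) (v j) then 1 else (0::real))) =
      (\<Sum>p | p permutes {0..<n}. if \<forall>i\<in>{0..<n}. R (v i) (v (p i)) then 1 else 0)"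
    unfolding permanent_def dim_row_mat dim_col_mat
  proof (simp only: refl if_True, intro sum.cong refl)
    fix p assume "p \<in> {p. p permutes {0..<n}}"
    then have "p i < n" if "i < n" for i using that permutes_in_image[of p "{0..<n}" i] by simp
    then have "(\<Prod>i = 0..<n. mat n n (\<lambda>(i, j). if R (v i) (v j) then 1 else (0::real)) $$ (i, p i)) =
        (\<Prod>i = 0..<n. if R (v i) (v (p i)) then 1 else 0)"
      by (intro prod.cong) auto
    also have "\<dots> = (if \<forall>i\<in>{0..<n}. R (v i) (v (p i)) then 1 else 0)"
      by (auto intro: prod_zero)
    finally show "(\<Prod>i = 0..<n. mat n n (\<lambda>(i, j). if R (v i) (v j) then 1 else (0::real)) $$ (i, p i)) =
        (if \<forall>i\<in>{0..<n}. R (v i) (v (p i)) then 1 else 0)" .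
  qed
  moreover have "\<dots> = real (card ?P)"
    by (simp add: sum.If_cases finite_permutations Collect_conj_eq)
  ultimately show ?thesis by simp
qed

text \<open>\<open>block_const_on_orbit\<close> applies to the blocks \<open>B (b z)\<close>;
  injectivity of \<open>B\<close> brings the equality back to indices.\<close>

lemma (in signed_block_graph) cycle_free_cover_blocks:
  fixes B :: "'i \<Rightarrow> ('a, 'a \<times> 'a) pre_digraph"
  assumes "finite I" and B: "bij_betw B I (blocks G)"
  shows "cycle_free_cover (pverts G) I (\<lambda>i. verts (B i))"
proof
  have BG: "B i \<in> blocks G" if "i \<in> I" for i using that B by (auto simp: bij_betw_def)
  then show "verts (B i) \<subseteq> pverts G" if "i \<in> I" for i using that block_verts_subset by blast
  show "finite (pverts G)" by (rule pair_finite_verts)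
  fix D \<pi> and b :: "'a \<Rightarrow> 'i" and x
  assume D: "D \<subseteq> pverts G" and \<pi>: "\<pi> permutes D" "\<And>x. x \<in> D \<Longrightarrow> \<pi> x \<noteq> x"
    and b: "\<And>x. x \<in> D \<Longrightarrow> b x \<in> I \<and> x \<in> verts (B (b x)) \<and> \<pi> x \<in> verts (B (b x))"
    and x: "x \<in> D"
  have "finite D" using D pair_finite_verts by (rule finite_subset)
  then have "B (b (\<pi> x)) = B (b x)"
    using \<pi> b BG x by (intro block_const_on_orbit[where D = D and b = "\<lambda>z. B (b z)"]) blast+
  moreover have "\<pi> x \<in> D" using \<pi>(1) x by (simp add: permutes_in_image)
  ultimately show "b (\<pi> x) = b x"
    using b[of x] b[of "\<pi> x"] x B by (auto simp: bij_betw_def dest: inj_onD)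
qed (rule assms(1))

theorem theorem6:
  fixes G :: "'a pair_pre_digraph" and w :: "'a set \<Rightarrow> real"
    and B :: "nat \<Rightarrow> ('a, 'a \<times> 'a) pre_digraph" and v :: "nat \<Rightarrow> 'a"
    and A :: "real mat" and n k :: nat
  assumes "signed_block_graph G w"
    and "balanced G w"
    and "\<And>x y. (x, y) \<in> parcs G \<Longrightarrow> w {x, y} = 1"
    and "card (pverts G) = n"
    and "bij_betw B {1..k} (blocks G)"
    and "bij_betw v {0..<n} (pverts G)"
    and "A = adjacency_mat G w v"
  shows "permanent A =
    (\<Sum>\<alpha> | \<alpha> \<in> {1..k} \<rightarrow>\<^sub>E (UNIV :: nat set)
          \<and> (\<Sum>i = 1..k. \<alpha> i) = n
          \<and> (\<forall>S. S \<noteq> {} \<and> S \<subseteq> {1..k} \<longrightarrow>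
                (\<Sum>i\<in>S. \<alpha> i) \<le> card (verts (with_proj G \<restriction> (\<Union>i\<in>S. verts (B i))))).
       \<Prod>i = 1..k. fact (\<alpha> i) * (\<Sum>j = 0..\<alpha> i. (- 1) ^ j / fact j))"
  proof -
  interpret signed_block_graph G w by (rule assms(1))
  interpret cover: cycle_free_cover "pverts G" "{1..k}" "\<lambda>i. verts (B i)"
    using finite_atLeastAtMost assms(5) by (rule cycle_free_cover_blocks)
  have blocks_B: "blocks G = B ` {1..k}"
    using assms(5) by (simp add: bij_betw_def)
  \<comment> \<open>Blocks contain every arc and are cliques, so their vertex sets determine
    adjacency.\<close>
  have arc_iff: "(x, y) \<in> parcs G \<longleftrightarrow> x \<noteq> y \<and> (\<exists>i\<in>{1..k}. x \<in> verts (B i) \<and> y \<in> verts (B i))"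
    for x y
  proof
    assume xy: "(x, y) \<in> parcs G"
    then obtain C where C: "C \<in> blocks G" "x \<in> verts C" "y \<in> verts C" using arc_in_block by blast
    from C(1) obtain i where "i \<in> {1..k}" "C = B i" unfolding blocks_B by blast
    moreover have "x \<noteq> y" using pair_no_loops[OF xy] by simp
    ultimately show "x \<noteq> y \<and> (\<exists>i\<in>{1..k}. x \<in> verts (B i) \<and> y \<in> verts (B i))"
      using C by auto
  next
    assume "x \<noteq> y \<and> (\<exists>i\<in>{1..k}. x \<in> verts (B i) \<and> y \<in> verts (B i))"
    then obtain i where "B i \<in> blocks G" "x \<in> verts (B i)" "y \<in> verts (B i)" "x \<noteq> y"
      unfolding blocks_B by blast
    then show "(x, y) \<in> parcs G" by (rule block_clique)
  qed
  have "A = mat n n (\<lambda>(i, j). if (v i, v j) \<in> parcs G then 1 else 0)"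
    unfolding assms(7) adjacency_mat_def assms(4) by (intro cong_mat) (auto simp: assms(3))
  then have "permanent A = real (card {p. p permutes pverts G \<and> (\<forall>x\<in>pverts G. (x, p x) \<in> parcs G)})"
    using permanent_zero_one[OF assms(6), of "\<lambda>x y. (x, y) \<in> parcs G"] by simp
  \<comment> \<open>Absence of loops is what makes these permutations derangements.\<close>
  also have "{p. p permutes pverts G \<and> (\<forall>x\<in>pverts G. (x, p x) \<in> parcs G)} =
      {p \<in> derangements (pverts G). \<forall>x\<in>pverts G. \<exists>i\<in>{1..k}. x \<in> verts (B i) \<and> p x \<in> verts (B i)}"
    by (auto simp: derangements_def arc_iff)
  finally show ?thesis
    by (simp only: cover.card_supported_derangements assms(4) induce_subgraph_verts)
qed

end
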